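(* Let $\alpha\in(1,\infty)$ and let $B:\mathbb R\setminus\{0\}\to\mathbb R$ be an even function that is positive, decreasing and convex on $(0,\infty)$ and satisfies, for some $\varepsilon>0$, $B(t)=\dfrac1{t\ln^\alpha(1/t)}$ for all $t\in(0,\varepsilon)$. Let $$E_n=\bigcup_{k=1}^n\Big(\frac1n\Big(k-\frac12-\frac{\operatorname{mes}E_n}{2}\Big),\ \frac1n\Big(k-\frac12+\frac{\operatorname{mes}E_n}{2}\Big)\Big)\subset(0,1),$$ i.e. $E_n$ consists of $n$ equidistant intervals of equal length with total Lebesgue measure $\operatorname{mes}E_n\in(0,1]$, and assume $$(\ln n)^{\alpha-1}\operatorname{mes}E_n\to\infty\quad\text{for }n\to\infty.$$ Put $g_n=(1/\operatorname{mes}E_n)\cdot\mathbf 1_{E_n}$ and $g=\mathbf 1_{(0,1)}$. Then $\|g_n-g\|_{G_{0,1}}\to0$ for $n\to\infty$.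
   Context: "Positive" and "decreasing" are understood in the weak sense. $G_{0,1}$ is the completion of real $L_2(0,1)$ with respect to the scalar product $\langle f,h\rangle=\iint f(s)h(t)B(s-t)\,ds\,dt$ (well defined and positive definite under the hypotheses), and $\|f\|_{G_{0,1}}=\langle f,f\rangle^{1/2}$. *)

theory Defs
  imports "HOL-Analysis.Analysis"
begin

text \<open>
  The scalar product on \<open>L\<^sub>2(0,1)\<close> whose completion is \<open>G\<^sub>0\<^sub>,\<^sub>1\<close>, for a kernel \<open>B\<close>. Elements of
  \<open>L\<^sub>2(0,1)\<close> are represented by Borel functions on the line, of which only the values on \<open>(0,1)\<close>
  matter. The value \<open>B 0\<close> is irrelevant, because the diagonal is a null set. The double
  integral converges absolutely on \<open>L\<^sub>2(0,1)\<close> whenever \<open>B\<close> is Borel, even and absolutely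
  integrable on \<open>(0,1)\<close>.
\<close>

definition G_inner :: "(real \<Rightarrow> real) \<Rightarrow> (real \<Rightarrow> real) \<Rightarrow> (real \<Rightarrow> real) \<Rightarrow> real" where
  "G_inner B f h =
     set_lebesgue_integral (lborel \<Otimes>\<^sub>M lborel) ({0<..<1} \<times> {0<..<1})
       (\<lambda>(s, t). f s * h t * B (s - t))"

text \<open>
  The completion extends this norm isometrically, so on elements of \<open>L\<^sub>2(0,1)\<close> it is
  the norm of \<open>G\<^sub>0\<^sub>,\<^sub>1\<close>.
\<close>

definition G_norm :: "(real \<Rightarrow> real) \<Rightarrow> (real \<Rightarrow> real) \<Rightarrow> real" where
  "G_norm B f = sqrt (G_inner B f f)"

end

(* For s fixed, split the potential \<integral> (g_n - g)(t) B(s - t) dt at distance 1/n from s. The near part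
   is at most of order (1/m) \<integral>_0^{1/n} B, i.e. 1 / (m ln^{\<alpha>-1} n) up to a constant, where m = mes E_n.
   The far part pairs a unimodal kernel bounded by B(1/n) with a function of mean zero on each of
   the n cells, so it is at most of order B(1/n)/n = 1 / ln^\<alpha> n. Hence the potential tends to zero
   uniformly in s, and the energy is at most its supremum times the L_1 norm of g_n - g, which is
   at most 2. *)

theory Submission
  imports Defs
begin

section \<open>The mass of the logarithmic singularity near zero\<close>

text \<open>Substituting u = ln(1/t) gives the antiderivative \<open>?F\<close>. It tends to 0 at 0
  from the right exactly because \<alpha> > 1 makes the exponent 1 - \<alpha> negative. As the
  integrand is nonnegative, the fundamental theorem on the open interval yields integrability and
  the value together.\<close>

lemma has_bochner_integral_log_kernel:
  fixes \<alpha> \<delta> :: real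
  assumes \<alpha>: "\<alpha> > 1" and \<delta>: "0 < \<delta>" "\<delta> < 1"
  shows "has_bochner_integral lborel
    (\<lambda>t. indicator {0<..<\<delta>} t * (1 / (t * ln (1 / t) powr \<alpha>)))
    (ln (1 / \<delta>) powr (1 - \<alpha>) / (\<alpha> - 1))"
proof -
  let ?f = "\<lambda>t::real. 1 / (t * ln (1 / t) powr \<alpha>)"
  let ?F = "\<lambda>t::real. ln (1 / t) powr (1 - \<alpha>) / (\<alpha> - 1)"
  have ein: "einterval 0 (ereal \<delta>) = {0<..<\<delta>}"
    by (auto simp: einterval_def zero_ereal_def)
  have D: "(?F has_real_derivative ?f x) (at x)" if "0 < x" "x < \<delta>" for x
  proof -
    have l: "ln (1 / x) > 0" using that \<delta> by (simp add: ln_div)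
    have p: "ln (1 / x) powr (1 - \<alpha> - 1) = 1 / ln (1 / x) powr \<alpha>"
      by (simp add: powr_minus_divide)
    have "((\<lambda>t. ln (1 / t)) has_real_derivative - 1 / x) (at x)"
      using that by (auto intro!: derivative_eq_intros simp: power2_eq_square)
    from DERIV_cdivide[OF DERIV_fun_powr[OF this l, of "1 - \<alpha>"], of "\<alpha> - 1"]
    show ?thesis
    proof (rule DERIV_cong)
      have "(1 - \<alpha>) * u * (- 1 / x) / (\<alpha> - 1) = u / x" for u :: real
        using \<alpha> that by (simp add: divide_simps) (simp add: algebra_simps)
      from this[of "1 / ln (1 / x) powr \<alpha>"]
      show "(1 - \<alpha>) * ln (1 / x) powr (1 - \<alpha> - of_nat 1) * (- 1 / x) / (\<alpha> - 1)
          = 1 / (x * ln (1 / x) powr \<alpha>)"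
        unfolding of_nat_1 p by (simp only: divide_divide_eq_left mult.commute[of x])
    qed
  qed
  have cont: "isCont ?f x" if "0 < x" "x < \<delta>" for x
    using that \<delta> by (intro continuous_intros) (auto simp: ln_div)
  have lim0: "(?F \<longlongrightarrow> 0) (at_right 0)"
  proof -
    have "filterlim (\<lambda>t::real. ln (1 / t)) at_top (at_right 0)"
      using filterlim_compose[OF ln_at_top filterlim_inverse_at_top_right]
      by (simp add: inverse_eq_divide)
    then have "((\<lambda>t::real. ln (1 / t) powr (1 - \<alpha>)) \<longlongrightarrow> 0) (at_right 0)"
      using tendsto_neg_powr[of "1 - \<alpha>"] \<alpha> by simp
    then show ?thesis using tendsto_divide_zero by blast
  qed
  have lim1: "(?F \<longlongrightarrow> ?F \<delta>) (at_left \<delta>)"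
  proof -
    have "isCont ?F \<delta>"
      using \<delta> \<alpha> by (intro continuous_intros) (auto simp: ln_div)
    then show ?thesis
      unfolding isCont_def using filterlim_at_split by blast
  qed
  have l0: "((?F \<circ> real_of_ereal) \<longlongrightarrow> 0) (at_right 0)"
    using lim0 by (simp add: zero_ereal_def ereal_tendsto_simps)
  have l1: "((?F \<circ> real_of_ereal) \<longlongrightarrow> ?F \<delta>) (at_left (ereal \<delta>))"
    using lim1 by (simp add: ereal_tendsto_simps)
  have nn: "AE x in lborel. 0 < ereal x \<longrightarrow> ereal x < ereal \<delta> \<longrightarrow> 0 \<le> ?f x"
    by (auto simp: zero_ereal_def intro!: AE_I2)
  note FTC = interval_integral_FTC_nonneg[where F = ?F and f = ?f and a = 0 and b = "ereal \<delta>",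
      OF _ _ _ nn l0 l1]
  have 1: "set_integrable lborel (einterval 0 (ereal \<delta>)) ?f"
    by (rule FTC(1)) (use \<delta> D cont in \<open>auto simp: zero_ereal_def\<close>)
  have 2: "(LBINT x=0..ereal \<delta>. ?f x) = ?F \<delta> - 0"
    by (rule FTC(2)) (use \<delta> D cont in \<open>auto simp: zero_ereal_def\<close>)
  show ?thesis
    using 1 2 \<delta>
    by (auto simp: has_bochner_integral_iff set_integrable_def interval_lebesgue_integral_def
        set_lebesgue_integral_def ein zero_ereal_def[symmetric])
qed

lemma has_bochner_integral_even_extension:
  fixes f :: "real \<Rightarrow> real"
  assumes "has_bochner_integral lborel f c"
  shows "has_bochner_integral lborel (\<lambda>x. f x + f (- x)) (2 * c)"
proof -
  have "has_bochner_integral lborel (\<lambda>x. f (- x)) c"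
    using lborel_has_bochner_integral_real_affine_iff[of "-1" f c 0] assms by simp
  then show ?thesis using has_bochner_integral_add[OF assms] by fastforce
qed

section \<open>Cancellation on cells and the structure of the comb\<close>

text \<open>The hypothesis \<open>mass\<close> gives the weight integral zero, so \<open>w\<close>
  may be replaced by \<open>w - c\<close>, which is at most \<open>D\<close> on the cell. The weight
  has L_1 norm at most 2 (b - a): each of its two terms has mass b - a.\<close>

lemma cell_integral_bound:
  fixes w :: "real \<Rightarrow> real"
  assumes m: "0 < m" and ab: "a \<le> a'" "a' \<le> b'" "b' \<le> b" and mass: "b' - a' = m * (b - a)"
    and w[measurable]: "w \<in> borel_measurable borel"
    and osc: "\<And>x. x \<in> {a<..b} \<Longrightarrow> \<bar>w x - c\<bar> \<le> D"
  shows "integrable lborel (\<lambda>t. (1 / m * indicator {a'<..<b'} t - indicator {a<..b} t) * w t)" (is ?I)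
    and "\<bar>\<integral>t. (1 / m * indicator {a'<..<b'} t - indicator {a<..b} t) * w t \<partial>lborel\<bar> \<le> 2 * D * (b - a)"
      (is ?B)
proof -
  let ?\<phi> = "\<lambda>t. 1 / m * indicator {a'<..<b'} t - indicator {a<..b} t :: real"
  \<comment> \<open>Adding the two terms instead of subtracting them gives a pointwise majorant of
    the absolute value of \<open>?\<phi>\<close> whose integral is immediate.\<close>
  let ?\<psi> = "\<lambda>t. 1 / m * indicator {a'<..<b'} t + indicator {a<..b} t :: real"
  have i1: "has_bochner_integral lborel (indicator {a'<..<b'} :: real \<Rightarrow> real) (b' - a')"
    using has_bochner_integral_real_indicator[of "{a'<..<b'}" lborel] ab by simp
  have i2: "has_bochner_integral lborel (indicator {a<..b} :: real \<Rightarrow> real) (b - a)"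
    using has_bochner_integral_real_indicator[of "{a<..b}" lborel] ab by simp
  have \<phi>: "has_bochner_integral lborel ?\<phi> 0"
    using has_bochner_integral_diff[OF has_bochner_integral_mult_right[OF i1, of "1 / m"] i2] m mass
    by simp
  have \<psi>: "has_bochner_integral lborel ?\<psi> (2 * (b - a))"
    using has_bochner_integral_add[OF has_bochner_integral_mult_right[OF i1, of "1 / m"] i2] m mass
    by simp
  have bound: "\<bar>?\<phi> t * (w t - c)\<bar> \<le> D * ?\<psi> t" for t
  proof (cases "t \<in> {a<..b}")
    case True
    have "\<bar>?\<phi> t\<bar> \<le> ?\<psi> t" using m by (auto simp: indicator_def abs_if)
    moreover have "\<bar>w t - c\<bar> \<le> D" using osc True by blast
    ultimately have "\<bar>?\<phi> t\<bar> * \<bar>w t - c\<bar> \<le> ?\<psi> t * D"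
      by (intro mult_mono) auto
    then show ?thesis by (simp add: abs_mult mult.commute)
  next
    case False
    then have "t \<notin> {a'<..<b'}" using ab by auto
    then show ?thesis using False by simp
  qed
  have D\<psi>: "has_bochner_integral lborel (\<lambda>t. D * ?\<psi> t) (D * (2 * (b - a)))"
    by (rule has_bochner_integral_mult_right[OF \<psi>])
  have I0: "integrable lborel (\<lambda>t. ?\<phi> t * (w t - c))"
    by (rule Bochner_Integration.integrable_bound[OF integrable.intros[OF D\<psi>]])
      (measurable, rule AE_I2, unfold real_norm_def, rule order_trans[OF bound abs_ge_self])
  have \<phi>c: "has_bochner_integral lborel (\<lambda>t. ?\<phi> t * c) 0"
    using has_bochner_integral_mult_left[OF \<phi>, of c] by simp
  have eq: "(\<lambda>t. ?\<phi> t * w t) = (\<lambda>t. ?\<phi> t * (w t - c) + ?\<phi> t * c)"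
    by (simp flip: distrib_left)
  show ?I
    unfolding eq using I0 \<phi>c by (intro Bochner_Integration.integrable_add) (auto simp: has_bochner_integral_iff)
  have "(\<integral>t. ?\<phi> t * w t \<partial>lborel) = (\<integral>t. ?\<phi> t * (w t - c) \<partial>lborel)"
    unfolding eq using I0 \<phi>c by (subst Bochner_Integration.integral_add) (auto simp: has_bochner_integral_iff)
  also have "\<bar>\<dots>\<bar> \<le> (\<integral>t. D * ?\<psi> t \<partial>lborel)"
    using integral_abs_bound_integral[OF I0 integrable.intros[OF D\<psi>]] bound by simp
  also have "\<dots> = 2 * D * (b - a)"
    using D\<psi> by (simp add: has_bochner_integral_iff)
  finally show ?B .
qed

text \<open>Taking the measure as a free parameter \<open>m\<close> breaks the self-reference in the
  equation for \<open>E n\<close>: the equation becomes an instance of an explicit set.\<close>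

definition comb :: "nat \<Rightarrow> real \<Rightarrow> real set" where
  "comb n m = (\<Union>k\<in>{1..n}. {1 / real n * (real k - 1 / 2 - m / 2)
                            <..< 1 / real n * (real k - 1 / 2 + m / 2)})"

definition comb_diff :: "nat \<Rightarrow> real \<Rightarrow> real \<Rightarrow> real" where
  "comb_diff n m t = 1 / m * indicator (comb n m) t - indicator {0<..<1} t"

text \<open>The cells are half-open so that they tile (0,1] without counting the common endpoints
  twice.\<close>

definition comb_cell :: "nat \<Rightarrow> real \<Rightarrow> nat \<Rightarrow> real \<Rightarrow> real" where
  "comb_cell n m k t = 1 / m * indicator {(real k - 1 / 2 - m / 2) / n<..<(real k - 1 / 2 + m / 2) / n} t
     - indicator {(real k - 1) / n<..real k / n} t"

lemma sum_indicator_cells: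
  fixes t :: real
  assumes "n \<ge> 1"
  shows "(\<Sum>k=1..N. indicator {(real k - 1) / real n<..real k / real n} t :: real)
    = indicator {0<..real N / real n} t"
proof (induction N)
  case 0
  then show ?case by simp
next
  case (Suc N)
  have "real N / real n \<le> (1 + real N) / real n" "0 \<le> real N / real n"
    by (auto intro: divide_right_mono)
  then show ?case
    using Suc by (auto simp: indicator_def intro: le_less_trans[OF divide_nonneg_nonneg[of "real N" "real n"]])
qed

text \<open>The cells tile (0,1], while \<open>comb_diff\<close> subtracts the indicator of (0,1);
  hence the exceptional point t = 1. The teeth are disjoint since their centres are at least 1/n
  apart and their width m/n is at most 1/n.\<close>

lemma comb_diff_eq_sum_cells:
  assumes n: "n \<ge> 1" and m: "0 < m" "m \<le> 1" and t: "t \<noteq> 1"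
  shows "comb_diff n m t = (\<Sum>k=1..n. comb_cell n m k t)"
proof -
  let ?I = "\<lambda>k. {(real k - 1 / 2 - m / 2) / real n<..<(real k - 1 / 2 + m / 2) / real n}"
  have comb: "comb n m = (\<Union>k\<in>{1..n}. ?I k)"
    by (simp add: comb_def)
  have "disjoint_family_on ?I {1..n}"
  proof -
    have "?I j \<inter> ?I k = {}" if "j < k" for j k
    proof -
      have "real j + 1 \<le> real k" using that by simp
      then have "(real j - 1 / 2 + m / 2) / real n \<le> (real k - 1 / 2 - m / 2) / real n"
        using m by (intro divide_right_mono) auto
      then show ?thesis by auto
    qed
    then show ?thesis
      unfolding disjoint_family_on_def by (metis Int_commute linorder_neqE_nat)
  qed
  then have "indicator (comb n m) t = (\<Sum>k=1..n. indicator (?I k) t :: real)"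
    unfolding comb by (intro indicator_UN_disjoint) auto
  moreover have "indicator {0<..<1} t = (\<Sum>k=1..n. indicator {(real k - 1) / real n<..real k / real n} t :: real)"
    using n t by (subst sum_indicator_cells) (auto simp: indicator_def)
  ultimately show ?thesis
    by (simp add: comb_diff_def comb_cell_def sum_subtractf sum_distrib_left)
qed

lemma comb_sets [measurable]: "comb n m \<in> sets borel"
  unfolding comb_def by measurable

lemma comb_diff_measurable [measurable]: "comb_diff n m \<in> borel_measurable borel"
  unfolding comb_diff_def by measurable

lemma comb_diff_bound:
  assumes "0 < m"
  shows "\<bar>comb_diff n m t\<bar> \<le> 1 / m + 1"
  using assms by (auto simp: comb_diff_def indicator_def abs_if)

lemma comb_diff_outside:
  assumes n: "n \<ge> 1" and m: "m \<le> 1" and t: "t \<notin> {0<..<1}"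
  shows "comb_diff n m t = 0"
proof -
  have "comb n m \<subseteq> {0<..<1}"
  proof
    fix t assume "t \<in> comb n m"
    then obtain k where k: "k \<in> {1..n}"
      "(real k - 1 / 2 - m / 2) / real n < t" "t < (real k - 1 / 2 + m / 2) / real n"
      by (auto simp: comb_def)
    have "0 \<le> (real k - 1 / 2 - m / 2) / real n" "(real k - 1 / 2 + m / 2) / real n \<le> 1"
      using k m n by (auto simp: field_simps)
    then show "t \<in> {0<..<1}" using k unfolding greaterThanLessThan_iff by linarith
  qed
  then have "t \<notin> comb n m" using t by auto
  then show ?thesis using t by (simp add: comb_diff_def)
qed

text \<open>Every cell of the comb carries zero mass, so \<open>w\<close> may be replaced on it by its deviation from a
  constant; the total deviation over all cells is the variation of \<open>w\<close>, of which \<open>V\<close> is a majorant.\<close>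

lemma comb_diff_integral_bounded_variation:
  fixes w V :: "real \<Rightarrow> real"
  assumes n: "n \<ge> 1" and m: "0 < m" "m \<le> 1"
    and w[measurable]: "w \<in> borel_measurable borel"
    and var: "\<And>x y. x \<le> y \<Longrightarrow> \<bar>w x - w y\<bar> \<le> V y - V x"
  shows "integrable lborel (\<lambda>t. comb_diff n m t * w t)" (is ?I)
    and "\<bar>\<integral>t. comb_diff n m t * w t \<partial>lborel\<bar> \<le> 2 / n * (V 1 - V 0)" (is ?B)
proof -
  have Vmono: "V x \<le> V y" if "x \<le> y" for x y
    using var[OF that] by linarith
  have cell: "integrable lborel (\<lambda>t. comb_cell n m k t * w t)"
    "\<bar>\<integral>t. comb_cell n m k t * w t \<partial>lborel\<bar> \<le> 2 / n * (V (real k / n) - V ((real k - 1) / n))" for k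
  proof -
    let ?a = "(real k - 1) / n" and ?b = "real k / n"
    have len: "?b - ?a = 1 / n" by (simp add: diff_divide_distrib)
    have ab: "?a \<le> (real k - 1 / 2 - m / 2) / n"
      "(real k - 1 / 2 - m / 2) / n \<le> (real k - 1 / 2 + m / 2) / n"
      "(real k - 1 / 2 + m / 2) / n \<le> ?b"
      using m by (auto intro!: divide_right_mono)
    have mass: "(real k - 1 / 2 + m / 2) / n - (real k - 1 / 2 - m / 2) / n = m * (?b - ?a)"
      unfolding len by (simp flip: diff_divide_distrib)
    \<comment> \<open>The constant subtracted on a cell is the value of \<open>w\<close> at its
      right end. Since \<open>V\<close> is increasing, the deviation is at most the increment of
      \<open>V\<close> over the whole cell, and these increments telescope.\<close>
    have osc: "\<bar>w x - w ?b\<bar> \<le> V ?b - V ?a" if "x \<in> {?a<..?b}" for x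
      using var[of x ?b] Vmono[of ?a x] that by auto
    note * = cell_integral_bound[OF m(1) ab mass w osc]
    show "integrable lborel (\<lambda>t. comb_cell n m k t * w t)"
      unfolding comb_cell_def by (rule *(1))
    show "\<bar>\<integral>t. comb_cell n m k t * w t \<partial>lborel\<bar> \<le> 2 / n * (V ?b - V ?a)"
      using *(2) unfolding comb_cell_def len by simp
  qed
  have [measurable]: "comb_cell n m k \<in> borel_measurable borel" for k
    unfolding comb_cell_def by measurable
  \<comment> \<open>Only t = 1 is lost, a null set.\<close>
  have AE: "AE t in lborel. comb_diff n m t * w t = (\<Sum>k=1..n. comb_cell n m k t * w t)"
    using AE_lborel_singleton[of 1]
    by eventually_elim (simp add: comb_diff_eq_sum_cells[OF n m] sum_distrib_right)
  have S: "integrable lborel (\<lambda>t. \<Sum>k=1..n. comb_cell n m k t * w t)"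
    using cell(1) by auto
  show ?I
    by (subst integrable_cong_AE[OF _ _ AE]) (use S in measurable)
  have "(\<integral>t. comb_diff n m t * w t \<partial>lborel) = (\<integral>t. (\<Sum>k=1..n. comb_cell n m k t * w t) \<partial>lborel)"
    by (rule integral_cong_AE[OF _ _ AE]) measurable
  also have "\<dots> = (\<Sum>k=1..n. \<integral>t. comb_cell n m k t * w t \<partial>lborel)"
    using cell(1) by (intro Bochner_Integration.integral_sum)
  also have "\<bar>\<dots>\<bar> \<le> (\<Sum>k=1..n. 2 / n * (V (real k / n) - V ((real k - 1) / n)))"
    using cell(2) by (intro order_trans[OF sum_abs] sum_mono)
  also have "\<dots> = 2 / n * (\<Sum>k=1..n. V (real k / n) - V ((real k - 1) / n))"
    by (simp add: sum_distrib_left)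
  also have "(\<Sum>k=1..n. V (real k / n) - V ((real k - 1) / n)) = V 1 - V 0"
    using sum_telescope''[of 0 n "\<lambda>k. V (real k / n)"] n by (simp add: atLeastSucAtMost_greaterThanAtMost[symmetric] flip: One_nat_def)
  finally show ?B .
qed

text \<open>The function has mean zero and is at least -1 on (0,1), so adding 2 there dominates its
  absolute value. The majorant has integral 2.\<close>

lemma comb_diff_L1:
  assumes n: "n \<ge> 1" and m: "0 < m" "m \<le> 1"
  shows "integrable lborel (\<lambda>t. \<bar>comb_diff n m t\<bar>)" "(\<integral>t. \<bar>comb_diff n m t\<bar> \<partial>lborel) \<le> 2"
proof -
  let ?h = "\<lambda>t. comb_diff n m t + 2 * indicator {0<..<1} t"
  have i: "has_bochner_integral lborel (\<lambda>t. 2 * indicator {0<..<1::real} t :: real) 2"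
    using has_bochner_integral_mult_right[OF has_bochner_integral_real_indicator[of "{0<..<1::real}" lborel], of 2]
    by simp
  \<comment> \<open>The constant function 1 has zero variation, so the majorant \<open>V\<close> = 0
    forces the integral to vanish.\<close>
  have f: "integrable lborel (comb_diff n m)" "(\<integral>t. comb_diff n m t \<partial>lborel) = 0"
    using comb_diff_integral_bounded_variation[OF n m, of "\<lambda>_. 1" "\<lambda>_. 0"] by auto
  have le: "\<bar>comb_diff n m t\<bar> \<le> ?h t" for t
    using comb_diff_outside[OF n m(2), of t] m by (auto simp: comb_diff_def indicator_def abs_if split: if_splits)
  have h: "integrable lborel ?h" "(\<integral>t. ?h t \<partial>lborel) = 2"
    using f i by (auto simp: has_bochner_integral_iff)
  show "integrable lborel (\<lambda>t. \<bar>comb_diff n m t\<bar>)" using f by auto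
  then have "(\<integral>t. \<bar>comb_diff n m t\<bar> \<partial>lborel) \<le> (\<integral>t. ?h t \<partial>lborel)"
    using h le by (intro integral_mono)
  then show "(\<integral>t. \<bar>comb_diff n m t\<bar> \<partial>lborel) \<le> 2" using h by simp
qed

section \<open>The potential of the comb difference\<close>

text \<open>\<open>V\<close> follows the kernel up to its peak at \<open>s\<close> and is reflected
  at height \<open>c 0\<close> afterwards, so it is increasing and accumulates the variation. For
  points on opposite sides of \<open>s\<close>, the two drops from the peak add up.\<close>

lemma unimodal_majorant:
  fixes c :: "real \<Rightarrow> real" and s :: real
  assumes c: "antimono c" "\<And>x. 0 \<le> c x" and xy: "x \<le> y"
  defines "V \<equiv> \<lambda>t. if t \<le> s then c (s - t) else 2 * c 0 - c (t - s)"
  shows "\<bar>c \<bar>s - x\<bar> - c \<bar>s - y\<bar>\<bar> \<le> V y - V x"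
proof -
  have mono: "c v \<le> c u" if "u \<le> v" for u v
    using c(1) that by (auto dest: antimonoD)
  consider "y \<le> s" | "x \<le> s" "s < y" | "s < x" using xy by linarith
  then show ?thesis
  proof cases
    case 1
    then show ?thesis using xy mono[of "s - y" "s - x"] by (simp add: V_def)
  next
    case 2
    then show ?thesis using c(2) mono[of 0 "s - x"] mono[of 0 "y - s"] by (simp add: V_def)
  next
    case 3
    then show ?thesis using xy mono[of "x - s" "y - s"] by (simp add: V_def)
  qed
qed

text \<open>The kernel is split into a singular part \<open>R\<close> of small mass and a bounded unimodal part.\<close>

lemma comb_diff_potential_bound:
  fixes B R c :: "real \<Rightarrow> real"
  assumes n: "n \<ge> 1" and m: "0 < m" "m \<le> 1"
    and c: "antimono c" "\<And>x. 0 \<le> c x"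
    and R: "has_bochner_integral lborel R r" "\<And>x. 0 \<le> R x"
    and B: "\<And>x. x \<noteq> 0 \<Longrightarrow> B x = R x + c \<bar>x\<bar>"
    and Bm [measurable]: "B \<in> borel_measurable borel"
  shows "\<bar>\<integral>t. comb_diff n m t * B (s - t) \<partial>lborel\<bar> \<le> (1 / m + 1) * r + 4 / n * c 0"
proof -
  let ?f = "comb_diff n m"
  have "(\<lambda>x. - c x) \<in> borel_measurable borel"
    using c(1) by (intro borel_measurable_mono) (auto simp: mono_def antimono_def)
  then have [measurable]: "c \<in> borel_measurable borel"
    using borel_measurable_uminus_eq by blast
  have [measurable]: "R \<in> borel_measurable borel"
    using R(1) by (auto simp: has_bochner_integral_iff)
  have Rs: "has_bochner_integral lborel (\<lambda>t. R (s - t)) r"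
    using lborel_has_bochner_integral_real_affine_iff[of "-1" R r s] R(1) by simp
  then have Rs': "has_bochner_integral lborel (\<lambda>t. (1 / m + 1) * R (s - t)) ((1 / m + 1) * r)"
    by (rule has_bochner_integral_mult_right)
  \<comment> \<open>The singular part admits no cancellation argument; the supremum of the comb
    difference is paid in full, which costs the factor 1/m.\<close>
  have le: "\<bar>?f t * R (s - t)\<bar> \<le> (1 / m + 1) * R (s - t)" for t
    using comb_diff_bound[OF m(1), of n t] R(2)[of "s - t"] by (simp add: abs_mult mult_right_mono)
  have fR: "integrable lborel (\<lambda>t. ?f t * R (s - t))"
    by (rule Bochner_Integration.integrable_bound[OF integrable.intros[OF Rs']])
      (measurable, rule AE_I2, unfold real_norm_def, rule order_trans[OF le abs_ge_self])
  have "\<bar>\<integral>t. ?f t * R (s - t) \<partial>lborel\<bar> \<le> (\<integral>t. (1 / m + 1) * R (s - t) \<partial>lborel)"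
    using integral_abs_bound_integral[OF fR integrable.intros[OF Rs']] le by simp
  then have near: "\<bar>\<integral>t. ?f t * R (s - t) \<partial>lborel\<bar> \<le> (1 / m + 1) * r"
    using has_bochner_integral_integral_eq[OF Rs] by simp
  define V where "V = (\<lambda>t. if t \<le> s then c (s - t) else 2 * c 0 - c (t - s))"
  have var: "\<bar>c \<bar>s - x\<bar> - c \<bar>s - y\<bar>\<bar> \<le> V y - V x" if "x \<le> y" for x y
    unfolding V_def by (rule unimodal_majorant[OF c that])
  \<comment> \<open>All values of \<open>V\<close> lie between 0 and \<open>2 * c 0\<close>,
    wherever \<open>s\<close> is relative to the unit interval.\<close>
  have "V 1 - V 0 \<le> 2 * c 0"
    using c(2)[of "s - 0"] c(2)[of "1 - s"] c(2)[of "0 - s"] antimonoD[OF c(1), of 0 "s - 1"]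
      antimonoD[OF c(1), of 0 "0 - s"] antimonoD[OF c(1), of 0 "s"] c(2)[of 0]
      antimonoD[OF c(1), of 0 "- s"]
    by (auto simp: V_def)
  then have "2 / n * (V 1 - V 0) \<le> 4 / n * c 0"
    using mult_left_mono[of "V 1 - V 0" "2 * c 0" "2 / n"] by simp
  moreover have "integrable lborel (\<lambda>t. ?f t * c \<bar>s - t\<bar>)"
    "\<bar>\<integral>t. ?f t * c \<bar>s - t\<bar> \<partial>lborel\<bar> \<le> 2 / n * (V 1 - V 0)"
    using comb_diff_integral_bounded_variation[OF n m, of "\<lambda>t. c \<bar>s - t\<bar>" V] var by auto
  ultimately have fc: "integrable lborel (\<lambda>t. ?f t * c \<bar>s - t\<bar>)"
    and far: "\<bar>\<integral>t. ?f t * c \<bar>s - t\<bar> \<partial>lborel\<bar> \<le> 4 / n * c 0"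
    by auto
  \<comment> \<open>The splitting of \<open>B\<close> says nothing about its value at 0, so t = s is
    excluded.\<close>
  have "AE t in lborel. ?f t * B (s - t) = ?f t * R (s - t) + ?f t * c \<bar>s - t\<bar>"
    using AE_lborel_singleton[of s] by eventually_elim (simp add: B distrib_left)
  then have "(\<integral>t. ?f t * B (s - t) \<partial>lborel) = (\<integral>t. ?f t * R (s - t) + ?f t * c \<bar>s - t\<bar> \<partial>lborel)"
    by (intro integral_cong_AE) auto
  also have "\<dots> = (\<integral>t. ?f t * R (s - t) \<partial>lborel) + (\<integral>t. ?f t * c \<bar>s - t\<bar> \<partial>lborel)"
    using fR fc by (rule Bochner_Integration.integral_add)
  finally show ?thesis using near far by linarith
qed

section \<open>The energy bound and the limit\<close>

text \<open>By Fubini the energy is the integral of the comb difference against its own potential,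
  hence at most \<open>K\<close> times the L_1 norm, which is at most 2.\<close>

lemma G_inner_comb_diff_bound:
  assumes n: "n \<ge> 1" and m: "0 < m" "m \<le> 1"
    and K: "\<And>s. \<bar>\<integral>t. comb_diff n m t * B (s - t) \<partial>lborel\<bar> \<le> K"
  shows "\<bar>G_inner B (comb_diff n m) (comb_diff n m)\<bar> \<le> 2 * K"
proof -
  let ?f = "comb_diff n m"
  let ?F = "\<lambda>(s, t). ?f s * ?f t * B (s - t)"
  have K0: "0 \<le> K" using K[of 0] by linarith
  \<comment> \<open>The comb difference vanishes outside (0,1), so restricting to the unit square
    changes nothing.\<close>
  have "indicator ({0<..<1} \<times> {0<..<1}) p *\<^sub>R ?F p = ?F p" for p :: "real \<times> real"
    using comb_diff_outside[OF n m(2)] by (cases p) (fastforce simp: indicator_def)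
  then have G: "G_inner B ?f ?f = integral\<^sup>L (lborel \<Otimes>\<^sub>M lborel) ?F"
    unfolding G_inner_def set_lebesgue_integral_def by presburger
  show ?thesis
  proof (cases "integrable (lborel \<Otimes>\<^sub>M lborel) ?F")
    \<comment> \<open>The Lebesgue integral of a non-integrable function is 0 by convention, which
      satisfies the bound because \<open>K\<close> is nonnegative.\<close>
    case False
    then show ?thesis using K0 G by (simp add: not_integrable_integral_eq)
  next
    case True
    let ?h = "\<lambda>s. \<integral>t. ?f t * B (s - t) \<partial>lborel"
    have eq: "(\<integral>t. ?F (s, t) \<partial>lborel) = ?f s * ?h s" for s
      by (simp add: mult.assoc)
    have le: "\<bar>?f s * ?h s\<bar> \<le> \<bar>?f s\<bar> * K" for s
      unfolding abs_mult by (intro mult_left_mono K) auto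
    have "integrable lborel (\<lambda>s. \<integral>t. ?F (s, t) \<partial>lborel)"
      using lborel_pair.integrable_fst'[OF True] .
    then have fh: "integrable lborel (\<lambda>s. ?f s * ?h s)" unfolding eq .
    have "G_inner B ?f ?f = (\<integral>s. ?f s * ?h s \<partial>lborel)"
      using lborel_pair.integral_fst'[OF True] unfolding G eq by simp
    also have "\<bar>\<dots>\<bar> \<le> (\<integral>s. \<bar>?f s\<bar> * K \<partial>lborel)"
      using integral_abs_bound_integral[OF fh, of "\<lambda>s. \<bar>?f s\<bar> * K"] comb_diff_L1(1)[OF n m] le by simp
    also have "\<dots> \<le> 2 * K"
      using mult_right_mono[OF comb_diff_L1(2)[OF n m] K0] by simp
    finally show ?thesis .
  qed
qed

text \<open>The kernel is truncated at the cell length 1/n. The first summand comes from the mass of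
  the excess over the truncation level, the second from the height of the truncated kernel.\<close>

lemma log_kernel_energy_bound:
  fixes B :: "real \<Rightarrow> real"
  assumes \<alpha>: "\<alpha> > 1"
    and even: "\<And>t. t \<noteq> 0 \<Longrightarrow> B (- t) = B t"
    and positive: "\<And>t. t > 0 \<Longrightarrow> B t \<ge> 0"
    and decreasing: "antimono_on {0<..} B"
    and near_0: "\<And>t. 0 < t \<Longrightarrow> t < \<epsilon> \<Longrightarrow> B t = 1 / (t * ln (1 / t) powr \<alpha>)"
    and n: "n \<ge> 2" "1 / n < \<epsilon>" and m: "0 < m" "m \<le> 1"
  shows "\<bar>G_inner B (comb_diff n m) (comb_diff n m)\<bar>
    \<le> 8 / (\<alpha> - 1) * inverse (ln n powr (\<alpha> - 1) * m) + 8 * ln (real n) powr - \<alpha>"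
proof -
  define \<delta> where "\<delta> = 1 / real n"
  have \<delta>: "0 < \<delta>" "\<delta> < 1" "\<delta> < \<epsilon>" using n by (auto simp: \<delta>_def)
  \<comment> \<open>On the positive axis \<open>q\<close> is the excess of \<open>B\<close> over
    \<open>B \<delta>\<close>, and \<open>c\<close> is \<open>B\<close> cut off at that height; they
    add up to \<open>B\<close>. Writing \<open>q\<close> with the explicit formula makes its
    integrability available before \<open>B\<close> is known to be measurable.\<close>
  define q where "q = (\<lambda>t. indicator {0<..<\<delta>} t * (1 / (t * ln (1 / t) powr \<alpha>)) - B \<delta> * indicator {0<..<\<delta>} t)"
  define R where "R = (\<lambda>x. q x + q (- x))"
  define c where "c = (\<lambda>x. B (max x \<delta>))"
  define L where "L = ln (real n) powr (1 - \<alpha>) / (\<alpha> - 1)"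
  define r where "r = 2 * (L - B \<delta> * \<delta>)"
  have anti: "B y \<le> B x" if "0 < x" "x \<le> y" for x y
    using decreasing that by (auto simp: monotone_on_def)
  have B\<delta>: "0 \<le> B \<delta>" using positive \<delta> by auto
  have c: "antimono c" "\<And>x. 0 \<le> c x"
    using \<delta> anti positive by (auto simp: c_def antimono_def max_def)
  have q: "q t = (if 0 < t \<and> t < \<delta> then B t - B \<delta> else 0)" for t
    using near_0[of t] \<delta> by (auto simp: q_def)
  have q0: "0 \<le> q t" for t using anti[of t \<delta>] by (auto simp: q)
  then have R0: "0 \<le> R x" for x by (simp add: R_def)
  have "has_bochner_integral lborel (indicator {0<..<\<delta>} :: real \<Rightarrow> real) \<delta>"
    using has_bochner_integral_real_indicator[of "{0<..<\<delta>}" lborel] \<delta> by simp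
  then have "has_bochner_integral lborel q (L - B \<delta> * \<delta>)"
    unfolding q_def L_def using has_bochner_integral_log_kernel[OF \<alpha> \<delta>(1,2)]
    by (intro has_bochner_integral_diff has_bochner_integral_mult_right) (simp_all add: \<delta>_def)
  then have R: "has_bochner_integral lborel R r"
    unfolding R_def r_def by (rule has_bochner_integral_even_extension)
  have BR: "B x = R x + c \<bar>x\<bar>" if "x \<noteq> 0" for x
    using that even[of x] by (auto simp: R_def c_def q max_def abs_if)
  \<comment> \<open>Measurability of \<open>B\<close> comes from the splitting itself:
    \<open>c\<close> is monotone, \<open>R\<close> is integrable, and the arbitrary value
    \<open>B 0\<close> affects a single point.\<close>
  have [measurable]: "B \<in> borel_measurable borel"
  proof -
    have "(\<lambda>x. - c x) \<in> borel_measurable borel"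
      using c(1) by (intro borel_measurable_mono) (auto simp: mono_def antimono_def)
    then have [measurable]: "c \<in> borel_measurable borel"
      using borel_measurable_uminus_eq by blast
    have [measurable]: "R \<in> borel_measurable borel"
      using R by (auto simp: has_bochner_integral_iff)
    have "B = (\<lambda>x. if x = 0 then B 0 else R x + c \<bar>x\<bar>)" using BR by auto
    also have "\<dots> \<in> borel_measurable borel" by measurable
    finally show ?thesis .
  qed
  have m1: "1 / m + 1 \<le> 2 / m" using m by (simp add: field_simps)
  have L0: "0 \<le> L" using \<alpha> by (simp add: L_def)
  have r: "r \<le> 2 * L" using B\<delta> \<delta> by (simp add: r_def)
  have "(1 / m + 1) * r \<le> (1 / m + 1) * (2 * L)"
    using r m by (intro mult_left_mono) auto
  also have "\<dots> \<le> 2 / m * (2 * L)" using m1 L0 by (intro mult_right_mono) auto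
  finally have near: "(1 / m + 1) * r \<le> 4 * L / m" by simp
  \<comment> \<open>Here \<open>c 0\<close> is B(1/n) = n / ln^\<alpha> n, and the factor n cancels
    against the 1/n gained from the cells.\<close>
  have far: "4 / n * c 0 = 4 * ln n powr - \<alpha>"
    using \<delta> near_0[of \<delta>] n by (simp add: c_def \<delta>_def powr_minus_divide)
  have "\<bar>\<integral>t. comb_diff n m t * B (s - t) \<partial>lborel\<bar> \<le> 4 * L / m + 4 * ln n powr - \<alpha>" for s
    using comb_diff_potential_bound[OF _ m c R R0 BR, of n s] n near far by simp
  then have "\<bar>G_inner B (comb_diff n m) (comb_diff n m)\<bar> \<le> 2 * (4 * L / m + 4 * ln n powr - \<alpha>)"
    using n m by (intro G_inner_comb_diff_bound) auto
  also have "L = 1 / (\<alpha> - 1) * inverse (ln n powr (\<alpha> - 1))"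
    unfolding L_def using powr_minus[of "ln n" "\<alpha> - 1"] by simp
  finally show ?thesis by (simp add: divide_inverse mult_ac distrib_left)
qed

theorem lemma10p7:
  fixes \<alpha> :: real
    and B :: "real \<Rightarrow> real"
    and E :: "nat \<Rightarrow> real set"
    and g :: "real \<Rightarrow> real"
    and gn :: "nat \<Rightarrow> real \<Rightarrow> real"
  assumes alpha: "\<alpha> \<in> {1<..}"
    and even: "\<And>t. t \<noteq> 0 \<Longrightarrow> B (- t) = B t"
    and positive: "\<And>t. t > 0 \<Longrightarrow> B t \<ge> 0"
    and decreasing: "antimono_on {0<..} B"
    and convex: "convex_on {0<..} B"
    and near_0: "\<exists>\<epsilon>>0. \<forall>t\<in>{0<..<\<epsilon>}. B t = 1 / (t * ln (1 / t) powr \<alpha>)"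
    and E_eq: "\<And>n. n \<ge> 1 \<Longrightarrow>
        E n = (\<Union>k\<in>{1..n}. {1 / real n * (real k - 1 / 2 - measure lborel (E n) / 2)
                            <..< 1 / real n * (real k - 1 / 2 + measure lborel (E n) / 2)})"
    and mes_E: "\<And>n. n \<ge> 1 \<Longrightarrow> measure lborel (E n) \<in> {0<..1}"
    and growth: "filterlim (\<lambda>n. ln (real n) powr (\<alpha> - 1) * measure lborel (E n)) at_top sequentially"
    and gn_eq: "\<And>n. n \<ge> 1 \<Longrightarrow> gn n = (\<lambda>t. 1 / measure lborel (E n) * indicator (E n) t)"
    and g_eq: "g = indicator {0<..<1}"
  shows "(\<lambda>n. G_norm B (\<lambda>t. gn n t - g t)) \<longlonglongrightarrow> 0"
proof -
  obtain \<epsilon> where \<epsilon>: "\<epsilon> > 0" "\<And>t. 0 < t \<Longrightarrow> t < \<epsilon> \<Longrightarrow> B t = 1 / (t * ln (1 / t) powr \<alpha>)"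
    using near_0 by auto
  have \<alpha>: "\<alpha> > 1" using alpha by simp
  let ?m = "\<lambda>n::nat. measure lborel (E n)"
  let ?f = "\<lambda>n t. gn n t - g t"
  have f: "?f n = comb_diff n (?m n)" if "n \<ge> 1" for n
  proof -
    have "E n = comb n (?m n)" unfolding comb_def by (rule E_eq[OF that])
    then show ?thesis
      using gn_eq[OF that] by (simp add: comb_diff_def g_eq fun_eq_iff)
  qed
  have small: "\<forall>\<^sub>F n in sequentially. 1 / real n < \<epsilon>"
    using order_tendstoD(2)[OF lim_1_over_n \<epsilon>(1)] .
  \<comment> \<open>The first summand tends to zero by \<open>growth\<close>, the second because ln
    n tends to infinity and \<alpha> is positive.\<close>
  have bound: "\<forall>\<^sub>F n in sequentially. norm (G_inner B (?f n) (?f n))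
    \<le> 8 / (\<alpha> - 1) * inverse (ln (real n) powr (\<alpha> - 1) * ?m n) + 8 * ln (real n) powr - \<alpha>"
    using small eventually_ge_at_top[of 2]
  proof eventually_elim
    case (elim n)
    then show ?case
      using log_kernel_energy_bound[OF \<alpha> even positive decreasing \<epsilon>(2), where n = n and m = "?m n"] mes_E[of n] f[of n]
      by simp
  qed
  have "filterlim (\<lambda>n. ln (real n)) at_top sequentially"
    using filterlim_compose[OF ln_at_top filterlim_real_sequentially] .
  then have "(\<lambda>n. ln (real n) powr - \<alpha>) \<longlonglongrightarrow> 0"
    by (rule tendsto_neg_powr[rotated]) (use \<alpha> in simp)
  moreover have "(\<lambda>n. inverse (ln (real n) powr (\<alpha> - 1) * ?m n)) \<longlonglongrightarrow> 0"
    by (rule tendsto_inverse_0_at_top[OF growth])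
  ultimately have "(\<lambda>n. 8 / (\<alpha> - 1) * inverse (ln (real n) powr (\<alpha> - 1) * ?m n) + 8 * ln (real n) powr - \<alpha>)
      \<longlonglongrightarrow> 8 / (\<alpha> - 1) * 0 + 8 * 0"
    by (intro tendsto_intros)
  then have "(\<lambda>n. 8 / (\<alpha> - 1) * inverse (ln (real n) powr (\<alpha> - 1) * ?m n) + 8 * ln (real n) powr - \<alpha>) \<longlonglongrightarrow> 0"
    by simp
  then have "(\<lambda>n. G_inner B (?f n) (?f n)) \<longlonglongrightarrow> 0"
    by (rule Lim_null_comparison[OF bound])
  then show ?thesis
    unfolding G_norm_def using tendsto_real_sqrt[of _ 0] by simp
qed

end
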